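(* Let $p>3$ be a prime. Then $$\sum_{k=0}^{p-1}\frac{\binom{3k}k\binom{6k}{3k}}{432^k(3k+1)}\equiv\begin{cases}\dfrac{2^{p-1}+2}{3\cdot 2^{(p-1)/3}}\pmod{p^2}&\text{if }p\equiv1\pmod6,\\[2mm] 2^{(p+1)/3}(2^{p-3}-1)\pmod{p^2}&\text{if }p\equiv5\pmod 6.\end{cases}$$
   Context: Congruences are taken in the ring $\mathbb Z_p$ of rational numbers whose denominators are not divisible by $p$. *)

theory Defs
  imports "HOL-Number_Theory.Number_Theory"
begin

(* quotient_of gives the numerator and denominator of a rational in lowest terms. *)
definition p_integral_rats :: "nat \<Rightarrow> rat set" where
  "p_integral_rats p = {x. \<not> int p dvd snd (quotient_of x)}"

(* Congruence modulo m in the ring of p-integral rationals.  Both sides are required to lie in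
   the ring, and the divisibility of their difference by m is meant in the ring, not in rat
   (where it would be trivial). *)
definition cong_p_integral :: "nat \<Rightarrow> rat \<Rightarrow> rat \<Rightarrow> rat \<Rightarrow> bool" where
  "cong_p_integral p m a b \<longleftrightarrow>
     a \<in> p_integral_rats p \<and> b \<in> p_integral_rats p \<and> (\<exists>c\<in>p_integral_rats p. a - b = m * c)"

end

theory Submission
  imports Defs
begin

text \<open>
  The summand is \<open>T a k / (3 k + 1)\<close> with \<open>T a k = (a gchoose k) ((-1 - a) gchoose k)\<close> for
  \<open>a = -1/6\<close> or, by symmetry, \<open>a = -5/6\<close>; one of these equals \<open>t - p/6\<close> for a natural number \<open>t\<close>.
  The sum \<open>S a\<close> over \<open>k < p\<close> satisfies
  \<open>(3 a + 1) S a - (3 a - 1) S (a - 1) = 2 (\<Prod>i=1..p-1. 1 - a\<^sup>2 / i\<^sup>2)\<close>, whose right-hand side vanishes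
  modulo \<open>p\<^sup>2\<close> for \<open>a = i - p/6\<close>, \<open>0 < i < p\<close>. Descending from \<open>t - p/6\<close> to \<open>-p/6\<close>, where \<open>S\<close> can be
  evaluated directly, leaves the quotient of the products of \<open>p - 2 c\<close> over \<open>c \<equiv> 2\<close> and over
  \<open>c \<equiv> 1\<close> modulo 3, \<open>1 \<le> c \<le> (p - 1)/2\<close>.

  This quotient is found modulo \<open>p\<^sup>2\<close> as in the proof of Gauss's lemma: sending \<open>c\<close> to \<open>c/2\<close> or
  \<open>(p - c)/2\<close>, whichever is an integer, permutes \<open>{1..(p - 1)/2}\<close> and respects the classes
  modulo 3. Comparing products yields powers of 2 times first-order terms in \<open>p\<close>, which are harmonic
  sums; comparing signed harmonic sums under the same permutation determines these modulo \<open>p\<close>.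
\<close>

section \<open>Products and counts along residue classes modulo 3\<close>

lemma prod_mod_3:
  fixes m k :: nat
  assumes "k = 1 \<or> k = 2"
  shows "(\<Prod>c\<in>{c \<in> {1..3 * m}. c mod 3 = k}. f c) = (\<Prod>i<m. f (3 * i + k))"
proof (induction m)
  case (Suc m)
  have "{c \<in> {1..3 * Suc m}. c mod 3 = k} = insert (3 * m + k) {c \<in> {1..3 * m}. c mod 3 = k}"
    using assms by (auto; presburger)
  moreover have "3 * m + k \<notin> {c \<in> {1..3 * m}. c mod 3 = k}" using assms by auto
  ultimately show ?case using Suc by (simp add: mult.commute)
qed simp

text \<open>Each step of the induction adds two elements of equal parity, whose signs cancel. The
  ranges are the half systems \<open>{1..(p - 1) div 2}\<close> for \<open>p = 6 m + 1\<close> and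
  \<open>p = 6 m + 5\<close>; the omitted class is that of \<open>- p\<close>.\<close>

lemma prod_sign_mod_3:
  fixes m :: nat
  shows
    "(\<Prod>c\<in>{c \<in> {1..3 * m}. c mod 3 \<noteq> 2}. (- 1) ^ c) = (1 :: 'a :: comm_ring_1)"
    "(\<Prod>c\<in>{c \<in> {1..3 * m + 2}. c mod 3 \<noteq> 1}. (- 1) ^ c) = (1 :: 'a :: comm_ring_1)"
proof (induction m)
  case (Suc m)
  have e: "{c \<in> {1..3 * Suc m}. c mod 3 \<noteq> 2}
      = insert (3 * m + 1) (insert (3 * m + 3) {c \<in> {1..3 * m}. c mod 3 \<noteq> 2})"
    "{c \<in> {1..3 * Suc m + 2}. c mod 3 \<noteq> 1}
      = insert (3 * m + 3) (insert (3 * m + 5) {c \<in> {1..3 * m + 2}. c mod 3 \<noteq> 1})"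
    by (auto; presburger)+
  show "(\<Prod>c\<in>{c \<in> {1..3 * Suc m}. c mod 3 \<noteq> 2}. (- 1) ^ c) = (1 :: 'a)"
    "(\<Prod>c\<in>{c \<in> {1..3 * Suc m + 2}. c mod 3 \<noteq> 1}. (- 1) ^ c) = (1 :: 'a)"
    unfolding e using Suc by (cases "even m"; simp)+
next
  case 0
  have "{c \<in> {1..3 * 0 + 2}. c mod 3 \<noteq> 1} = {2::nat}"
    by (auto simp: numeral_2_eq_2 le_Suc_eq)
  then show "(\<Prod>c\<in>{c \<in> {1..3 * (0::nat) + 2}. c mod 3 \<noteq> 1}. (- 1) ^ c) = (1 :: 'a)"
    by simp
qed simp

text \<open>These counts evaluate the exponent of 2 in \<open>class_prod_cg\<close>.\<close>

lemma card_mod_3: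
  fixes m :: nat
  shows
    "card {c \<in> {1..3 * m}. c mod 3 \<noteq> 2} = 2 * m"
    "card {c \<in> {1..3 * m + 2}. c mod 3 \<noteq> 1} = 2 * m + 1"
proof (induction m)
  case (Suc m)
  have e: "{c \<in> {1..3 * Suc m}. c mod 3 \<noteq> 2}
      = insert (3 * m + 1) (insert (3 * m + 3) {c \<in> {1..3 * m}. c mod 3 \<noteq> 2})"
    "{c \<in> {1..3 * Suc m + 2}. c mod 3 \<noteq> 1}
      = insert (3 * m + 3) (insert (3 * m + 5) {c \<in> {1..3 * m + 2}. c mod 3 \<noteq> 1})"
    by (auto; presburger)+
  show "card {c \<in> {1..3 * Suc m}. c mod 3 \<noteq> 2} = 2 * Suc m"
    "card {c \<in> {1..3 * Suc m + 2}. c mod 3 \<noteq> 1} = 2 * Suc m + 1"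
    unfolding e using Suc by simp_all
next
  case 0
  have "{c \<in> {1..3 * 0 + 2}. c mod 3 \<noteq> 1} = {2::nat}"
    by (auto simp: numeral_2_eq_2 le_Suc_eq)
  then show "card {c \<in> {1..3 * (0::nat) + 2}. c mod 3 \<noteq> 1} = 2 * 0 + 1"
    by simp
qed simp

section \<open>Arithmetic of p-integral rationals\<close>

locale prime_gt_3 =
  fixes p :: nat
  assumes prime_p: "prime p" and p_gt_3: "p > 3"
begin

abbreviation P :: rat where "P \<equiv> of_nat p"
abbreviation Z :: "rat set" where "Z \<equiv> p_integral_rats p"

lemma P_nonzero [simp]: "p \<noteq> 0" "P \<noteq> 0"
  using p_gt_3 by auto

text \<open>The reduced denominator divides every other denominator, so unreduced fractions may be
  used too, as the closure proofs for sums and products do.\<close>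

lemma mem_Z_iff: "x \<in> Z \<longleftrightarrow> (\<exists>a b. \<not> int p dvd b \<and> x = of_int a / of_int b)"
proof
  assume "x \<in> Z"
  then show "\<exists>a b. \<not> int p dvd b \<and> x = of_int a / of_int b"
    by (intro exI[of _ "fst (quotient_of x)"] exI[of _ "snd (quotient_of x)"])
       (auto simp: p_integral_rats_def intro: quotient_of_div)
next
  assume "\<exists>a b. \<not> int p dvd b \<and> x = of_int a / of_int b"
  then obtain a b where b: "\<not> int p dvd b" and x: "x = of_int a / of_int b" by blast
  obtain c d where q: "quotient_of x = (c, d)" by force
  have d: "d > 0" "x = of_int c / of_int d" "coprime c d"
    using q quotient_of_denom_pos quotient_of_div quotient_of_coprime by blast+
  have "b \<noteq> 0" using b by auto
  then have "of_int (a * d) = (of_int (c * b) :: rat)"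
    using d x by (simp add: field_simps)
  then have "a * d = c * b" by (simp only: of_int_eq_iff)
  then have "d dvd c * b" by (metis dvd_triv_right)
  then have "d dvd b" using d(3) by (simp add: coprime_commute coprime_dvd_mult_right_iff)
  then show "x \<in> Z" using b q by (auto simp: p_integral_rats_def dest: dvd_trans)
qed

lemma Z_of_int [simp]: "of_int a \<in> Z"
  unfolding mem_Z_iff using p_gt_3 by (intro exI[of _ a] exI[of _ 1]) auto

lemma Z_of_nat [simp]: "of_nat a \<in> Z"
  using Z_of_int[of "int a"] by simp

lemma Z_numeral [simp]: "0 \<in> Z" "1 \<in> Z" "numeral w \<in> Z"
  using Z_of_int[of 0] Z_of_int[of 1] Z_of_int[of "numeral w"] by simp_all

lemma prime_int_p: "prime (int p)"
  using prime_p by simp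

lemma Z_add [simp]: "x \<in> Z \<Longrightarrow> y \<in> Z \<Longrightarrow> x + y \<in> Z"
  unfolding mem_Z_iff
proof (elim exE conjE)
  fix a b c d assume *: "\<not> int p dvd b" "x = of_int a / of_int b" "\<not> int p dvd d" "y = of_int c / of_int d"
  then have "b \<noteq> 0" "d \<noteq> 0" by auto
  then have "x + y = of_int (a * d + c * b) / of_int (b * d)" using * by (simp add: field_simps)
  moreover have "\<not> int p dvd b * d" using * prime_int_p by (simp add: prime_dvd_mult_iff)
  ultimately show "\<exists>a b. \<not> int p dvd b \<and> x + y = of_int a / of_int b" by blast
qed

lemma Z_mult [simp]: "x \<in> Z \<Longrightarrow> y \<in> Z \<Longrightarrow> x * y \<in> Z"
  unfolding mem_Z_iff
proof (elim exE conjE)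
  fix a b c d assume *: "\<not> int p dvd b" "x = of_int a / of_int b" "\<not> int p dvd d" "y = of_int c / of_int d"
  then have "x * y = of_int (a * c) / of_int (b * d)" by simp
  moreover have "\<not> int p dvd b * d" using * prime_int_p by (simp add: prime_dvd_mult_iff)
  ultimately show "\<exists>a b. \<not> int p dvd b \<and> x * y = of_int a / of_int b" by blast
qed

lemma Z_uminus [simp]: "x \<in> Z \<Longrightarrow> - x \<in> Z"
  using Z_mult[of "of_int (-1)" x, OF Z_of_int] by simp

lemma Z_diff [simp]: "x \<in> Z \<Longrightarrow> y \<in> Z \<Longrightarrow> x - y \<in> Z"
  using Z_add[of x "- y"] by simp

lemma Z_power [simp]: "x \<in> Z \<Longrightarrow> x ^ k \<in> Z"
  by (induction k) auto

lemma Z_sum [simp]: "(\<And>i. i \<in> A \<Longrightarrow> f i \<in> Z) \<Longrightarrow> sum f A \<in> Z"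
  by (induction A rule: infinite_finite_induct) auto

lemma Z_prod [simp]: "(\<And>i. i \<in> A \<Longrightarrow> f i \<in> Z) \<Longrightarrow> prod f A \<in> Z"
  by (induction A rule: infinite_finite_induct) auto

lemma Z_divide_int: "\<not> int p dvd b \<Longrightarrow> x \<in> Z \<Longrightarrow> x / of_int b \<in> Z"
proof -
  assume "\<not> int p dvd b" "x \<in> Z"
  moreover from this have "of_int 1 / of_int b \<in> Z" unfolding mem_Z_iff by blast
  ultimately show ?thesis using Z_mult[of x "of_int 1 / of_int b"] by simp
qed

lemma Z_divide_nat: "\<not> p dvd c \<Longrightarrow> x \<in> Z \<Longrightarrow> x / of_nat c \<in> Z"
  using Z_divide_int[of "int c" x] by (simp add: int_dvd_int_iff)

lemma Z_divide_less: "0 < c \<Longrightarrow> c < p \<Longrightarrow> x \<in> Z \<Longrightarrow> x / of_nat c \<in> Z"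
  by (rule Z_divide_nat) (auto dest: dvd_imp_le)

lemma Z_divide_2 [simp]: "x \<in> Z \<Longrightarrow> x / 2 \<in> Z"
  using Z_divide_less[of 2 x] p_gt_3 by simp

lemma Z_divide_3 [simp]: "x \<in> Z \<Longrightarrow> x / 3 \<in> Z"
  using Z_divide_less[of 3 x] p_gt_3 by simp

lemma Z_divide_4 [simp]: "x \<in> Z \<Longrightarrow> x / 4 \<in> Z"
  using Z_divide_2[of "x / 2"] by simp

lemma Z_divide_6 [simp]: "x \<in> Z \<Longrightarrow> x / 6 \<in> Z"
  using Z_divide_3[of "x / 2"] by simp

section \<open>Congruences modulo powers of p\<close>

text \<open>Only the difference is constrained, which keeps transitivity and sums free of side
  conditions; \<open>cg_mem\<close> carries p-integrality across a congruence.\<close>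

definition cg :: "nat \<Rightarrow> rat \<Rightarrow> rat \<Rightarrow> bool" where
  "cg k x y \<longleftrightarrow> (\<exists>c\<in>Z. x - y = P ^ k * c)"

lemma cgI: "c \<in> Z \<Longrightarrow> x - y = P ^ k * c \<Longrightarrow> cg k x y"
  unfolding cg_def by blast

lemma cg_refl [simp]: "cg k x x"
  by (rule cgI[of 0]) auto

lemma cg_sym: "cg k x y \<Longrightarrow> cg k y x"
  unfolding cg_def
proof (elim bexE)
  fix c assume "c \<in> Z" "x - y = P ^ k * c"
  then show "\<exists>c\<in>Z. y - x = P ^ k * c" by (intro bexI[of _ "-c"]) (auto simp: algebra_simps)
qed

lemma cg_add: "cg k x y \<Longrightarrow> cg k x' y' \<Longrightarrow> cg k (x + x') (y + y')"
  unfolding cg_def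
proof (elim bexE)
  fix c d assume "c \<in> Z" "x - y = P ^ k * c" "d \<in> Z" "x' - y' = P ^ k * d"
  then show "\<exists>c\<in>Z. x + x' - (y + y') = P ^ k * c"
    by (intro bexI[of _ "c + d"]) (auto simp: algebra_simps)
qed

lemma cg_trans [trans]: "cg k x y \<Longrightarrow> cg k y z \<Longrightarrow> cg k x z"
  using cg_add[of k x y y z] unfolding cg_def by simp

lemma cg_uminus: "cg k x y \<Longrightarrow> cg k (- x) (- y)"
  using cg_sym[of k x y] unfolding cg_def by simp

lemma cg_diff: "cg k x y \<Longrightarrow> cg k x' y' \<Longrightarrow> cg k (x - x') (y - y')"
  using cg_add[OF _ cg_uminus, of k x y x' y'] by simp

lemma cg_cmult: "z \<in> Z \<Longrightarrow> cg k x y \<Longrightarrow> cg k (z * x) (z * y)"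
  unfolding cg_def
proof (elim bexE)
  fix c assume "z \<in> Z" "c \<in> Z" "x - y = P ^ k * c"
  then show "\<exists>c\<in>Z. z * x - z * y = P ^ k * c"
    by (intro bexI[of _ "z * c"]) (auto simp: algebra_simps simp flip: right_diff_distrib)
qed

lemma cg_mult: "x \<in> Z \<Longrightarrow> y' \<in> Z \<Longrightarrow> cg k x y \<Longrightarrow> cg k x' y' \<Longrightarrow> cg k (x * x') (y * y')"
  using cg_cmult[of x k x' y'] cg_cmult[of y' k x y] by (auto simp: mult.commute intro: cg_trans)

lemma cg_sum: "(\<And>i. i \<in> A \<Longrightarrow> cg k (f i) (g i)) \<Longrightarrow> cg k (sum f A) (sum g A)"
  by (induction A rule: infinite_finite_induct) (auto intro: cg_add)

text \<open>Harmonic sums occur below with a factor \<open>P\<close>, so their values modulo p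
  suffice modulo p^2.\<close>

lemma cg_P_mult: "cg k x y \<Longrightarrow> cg (Suc k) (P * x) (P * y)"
  unfolding cg_def
proof (elim bexE)
  fix c assume "c \<in> Z" "x - y = P ^ k * c"
  then show "\<exists>c\<in>Z. P * x - P * y = P ^ Suc k * c"
    by (intro bexI[of _ c]) (auto simp: algebra_simps simp flip: right_diff_distrib)
qed

lemma cg_cancel:
  assumes "1 / u \<in> Z" "u \<noteq> 0" "cg k (u * x) (u * y)"
  shows "cg k x y"
  using cg_cmult[OF assms(1,3)] assms(2) by simp

lemma cg_mem: "cg k x y \<Longrightarrow> y \<in> Z \<Longrightarrow> x \<in> Z"
  unfolding cg_def
proof (elim bexE)
  fix c assume "y \<in> Z" "c \<in> Z" "x - y = P ^ k * c"
  then have "x = y + P ^ k * c" "y + P ^ k * c \<in> Z" by (auto simp: algebra_simps)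
  then show "x \<in> Z" by simp
qed

text \<open>In the expanded product, terms with two or more of the \<open>y i\<close> are divisible
  by p^2.\<close>

lemma cg_prod_first_order:
  assumes "finite A" "\<And>i. i \<in> A \<Longrightarrow> y i \<in> Z"
  shows "cg 2 (\<Prod>i\<in>A. 1 + P * y i) (1 + P * (\<Sum>i\<in>A. y i))"
  using assms
proof (induction A rule: finite_induct)
  case (insert j A)
  let ?s = "\<Sum>i\<in>A. y i"
  have "cg 2 ((1 + P * y j) * (\<Prod>i\<in>A. 1 + P * y i)) ((1 + P * y j) * (1 + P * ?s))"
    using insert by (intro cg_cmult) auto
  also have "cg 2 \<dots> (1 + P * (y j + ?s))"
    using insert by (intro cgI[of "y j * ?s"]) (auto simp: algebra_simps power2_eq_square)
  finally show ?case using insert by simp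
qed simp

section \<open>The hypergeometric sum and its recurrence in the parameter\<close>

text \<open>\<open>T a k\<close> is \<open>(a gchoose k) * ((-1 - a) gchoose k)\<close>.\<close>
definition T :: "rat \<Rightarrow> nat \<Rightarrow> rat" where
  "T a k = (\<Prod>i<k. (of_nat i - a) * (of_nat i + 1 + a) / (of_nat i + 1) ^ 2)"

definition S :: "rat \<Rightarrow> nat \<Rightarrow> rat" where
  "S a n = (\<Sum>k<n. T a k / (3 * of_nat k + 1))"

definition Q :: "rat \<Rightarrow> nat \<Rightarrow> rat" where
  "Q a n = (\<Prod>i=1..n. 1 - a ^ 2 / of_nat i ^ 2)"

lemma T_Suc: "T a (Suc k) = T a k * ((of_nat k - a) * (of_nat k + 1 + a) / (of_nat k + 1) ^ 2)"
  by (simp add: T_def)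

lemma Q_Suc: "Q a (Suc n) = Q a n * (1 - a ^ 2 / (of_nat n + 1) ^ 2)"
  by (simp add: Q_def add.commute)

lemma of_nat_plus_one_neq_0 [simp]: "of_nat k + 1 \<noteq> (0 :: rat)" "3 * of_nat k + 1 \<noteq> (0 :: rat)"
  using of_nat_0_le_iff[of k, where 'a = rat] by linarith+

text \<open>Shifting the second factors by one index pairs \<open>i - a\<close> with
  \<open>i + a\<close> for \<open>1 \<le> i \<le> n\<close>; only \<open>- a\<close> and
  \<open>n + 1 + a\<close> stay unpaired.\<close>

lemma T_Suc_eq_Q: "T a (Suc n) = - a * (of_nat n + 1 + a) / (of_nat n + 1) ^ 2 * Q a n"
proof (induction n)
  case (Suc n)
  define N :: rat where "N = of_nat n + 1"
  have N: "N \<noteq> 0" "N + 1 \<noteq> 0" "of_nat (Suc n) = N"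
    using of_nat_0_le_iff[of n, where 'a = rat] unfolding N_def by (linarith | simp)+
  show ?case
    unfolding T_Suc[of a "Suc n"] Suc Q_Suc N(3) N_def[symmetric] using N(1,2)
    by (simp add: divide_simps) (simp add: algebra_simps power2_eq_square)
qed (simp add: T_def Q_def)

text \<open>The same pairing leaves \<open>a\<close> and \<open>n + 1 - a\<close>. The common factor
  \<open>Q a n\<close> makes the terms at \<open>a\<close> and \<open>a - 1\<close>
  comparable.\<close>

lemma T_shift_Suc_eq_Q: "T (a - 1) (Suc n) = a * (of_nat n + 1 - a) / (of_nat n + 1) ^ 2 * Q a n"
proof (induction n)
  case (Suc n)
  define N :: rat where "N = of_nat n + 1"
  have N: "N \<noteq> 0" "N + 1 \<noteq> 0" "of_nat (Suc n) = N"
    using of_nat_0_le_iff[of n, where 'a = rat] unfolding N_def by (linarith | simp)+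
  show ?case
    unfolding T_Suc[of "a - 1" "Suc n"] Suc Q_Suc N(3) N_def[symmetric] using N(1,2)
    by (simp add: divide_simps) (simp add: algebra_simps power2_eq_square)
qed (simp add: T_def Q_def)

lemma S_recurrence: "(3 * a + 1) * S a (Suc n) - (3 * a - 1) * S (a - 1) (Suc n) = 2 * Q a n"
proof (induction n)
  case (Suc n)
  define N :: rat where "N = of_nat n + 1"
  have N: "N \<noteq> 0" "3 * N + 1 \<noteq> 0" "of_nat (Suc n) = N"
    using of_nat_0_le_iff[of n, where 'a = rat] unfolding N_def by (linarith | simp)+
  have S: "S c (Suc (Suc n)) = S c (Suc n) + T c (Suc n) / (3 * N + 1)" for c
    by (simp add: S_def N(3) del: of_nat_Suc)
  \<comment> \<open>The numerator \<open>- a (3 a + 1) (N + a) - a (3 a - 1) (N - a)\<close> equals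
    \<open>- 2 a^2 (3 N + 1)\<close>, so the denominator cancels.\<close>
  have "(3 * a + 1) * (T a (Suc n) / (3 * N + 1)) - (3 * a - 1) * (T (a - 1) (Suc n) / (3 * N + 1))
        = 2 * Q a n * (- (a ^ 2 / N ^ 2))"
    unfolding T_Suc_eq_Q[of a] T_shift_Suc_eq_Q N_def[symmetric] using N
    by (simp add: divide_simps) (simp add: algebra_simps power2_eq_square)
  then show ?case
    using Suc unfolding S Q_Suc N_def[symmetric] by (simp add: algebra_simps)
qed (simp add: S_def Q_def T_def)

text \<open>Consecutive multinomials \<open>(6 k)! / (k! (2 k)! (3 k)!)\<close> have quotient
  \<open>12 (6 k + 1) (6 k + 5) / (k + 1)^2\<close>, and \<open>432 = 12 * 36\<close>.\<close>

lemma T_sixth: "T (- 1 / 6) k = of_nat ((3 * k) choose k) * of_nat ((6 * k) choose (3 * k)) / 432 ^ k"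
proof (induction k)
  case (Suc k)
  define K :: rat where "K = of_nat k"
  have b: "of_nat ((3 * k) choose k) * of_nat ((6 * k) choose (3 * k))
            = (fact (6 * k) / (fact k * fact (2 * k) * fact (3 * k)) :: rat)" for k
    by (simp add: binomial_fact)
  have K: "K \<ge> 0" by (simp add: K_def)
  have f: "fact (6 * Suc k) = (6*K+1)*(6*K+2)*(6*K+3)*(6*K+4)*(6*K+5)*(6*K+6) * (fact (6 * k) :: rat)"
      "fact (3 * Suc k) = (3*K+1)*(3*K+2)*(3*K+3) * (fact (3 * k) :: rat)"
      "fact (2 * Suc k) = (2*K+1)*(2*K+2) * (fact (2 * k) :: rat)"
      "fact (Suc k) = (K+1) * (fact k :: rat)"
    by (simp_all add: K_def numeral_eq_Suc algebra_simps)
  have "K+1 \<noteq> 0" "2*K+1 \<noteq> 0" "2*K+2 \<noteq> 0" "3*K+1 \<noteq> 0" "3*K+2 \<noteq> 0" "3*K+3 \<noteq> 0"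
    using K by linarith+
  then show ?case
    unfolding T_Suc Suc b f K_def[symmetric]
    by (simp add: divide_simps) (simp add: algebra_simps power2_eq_square)
qed (simp add: T_def)

text \<open>The two factors of each term change places. This trades \<open>-1/6\<close> for
  \<open>-5/6\<close> when \<open>p = 6 t + 5\<close>.\<close>

lemma T_symmetric: "T (- 1 - a) k = T a k"
  unfolding T_def by (intro prod.cong) (auto simp: algebra_simps)

section \<open>Harmonic sums, the descent, and the value at \<open>- P / 6\<close>\<close>

lemma cg_inverse:
  assumes "cg k x y" "1 / x \<in> Z" "1 / y \<in> Z" "x \<noteq> 0" "y \<noteq> 0"
  shows "cg k (1 / x) (1 / y)"
proof -
  have "cg k ((1 / x * (1 / y)) * y) ((1 / x * (1 / y)) * x)"
    using assms by (intro cg_cmult cg_sym[OF assms(1)] Z_mult)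
  then show ?thesis using assms by simp
qed

text \<open>Pair \<open>k\<close> with \<open>p - k\<close>: the two reciprocals add up to
  \<open>p / (k (p - k))\<close>.\<close>

lemma sum_inverse_cg_0: "cg 1 (\<Sum>k=1..<p. 1 / of_nat k) 0"
proof -
  have "(\<Sum>k=1..<p. 1 / of_nat k) = (\<Sum>k=1..<p. 1 / (of_nat (p - k) :: rat))"
    by (rule sum.reindex_bij_witness[of _ "\<lambda>k. p - k" "\<lambda>k. p - k"]) auto
  then have "2 * (\<Sum>k=1..<p. 1 / of_nat k) = (\<Sum>k=1..<p. 1 / of_nat k + 1 / (of_nat (p - k) :: rat))"
    by (simp add: sum.distrib)
  also have "\<dots> = (\<Sum>k=1..<p. P * (1 / of_nat k / of_nat (p - k)))"
    by (intro sum.cong) (auto simp: field_simps of_nat_diff)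
  also have "\<dots> = P * (\<Sum>k=1..<p. 1 / of_nat k / of_nat (p - k))"
    by (simp add: sum_distrib_left)
  finally have "(\<Sum>k=1..<p. 1 / of_nat k) - 0 = P ^ 1 * ((\<Sum>k=1..<p. 1 / of_nat k / of_nat (p - k)) / 2)"
    by simp
  moreover have "(\<Sum>k=1..<p. 1 / of_nat k / of_nat (p - k)) / 2 \<in> Z"
    by (intro Z_divide_2 Z_sum Z_divide_less) auto
  ultimately show ?thesis by (rule cgI[rotated])
qed

lemma cg_of_nat_mod: "cg 1 (of_nat (m mod p)) (of_nat m)"
proof -
  have "of_nat m = of_nat (m mod p) + P * of_nat (m div p)"
    by (simp only: of_nat_mult[symmetric] of_nat_add[symmetric] mod_mult_div_eq)
  then have "of_nat (m mod p) - of_nat m = P ^ 1 * - of_nat (m div p)"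
    by (simp only: power_one_right mult_minus_right minus_add_distrib diff_conv_add_uminus
        add.right_inverse add_0_left flip: add.assoc)
  then show ?thesis by (rule cgI[rotated]) simp
qed

lemma three_mult_plus_one_cong_imp_eq:
  assumes "x < p" "y < p" "[3 * x + 1 = 3 * y + 1] (mod p)"
  shows "x = y"
proof -
  have "coprime 3 p" using prime_p p_gt_3
    by (metis coprime_commute dvd_imp_le not_less prime_imp_coprime zero_less_numeral)
  then have "[x = y] (mod p)"
    using assms(3) by (simp only: cong_add_rcancel_nat cong_mult_lcancel_nat)
  then show ?thesis using assms cong_less_modulus_unique_nat by blast
qed

text \<open>With \<open>a = i - P / 6\<close>, two numerators are divisible by p:
  \<open>i - a = P / 6\<close> and \<open>(p - i) + a = 5 P / 6\<close>.\<close>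

lemma Q_cg_0:
  assumes i: "1 \<le> i" "i < p"
  shows "cg 2 (Q (of_nat i - P / 6) (p - 1)) 0"
proof -
  define a where "a = of_nat i - P / 6"
  have a: "a \<in> Z" by (simp add: a_def)
  let ?f = "\<lambda>j. (of_nat j - a) / of_nat j" and ?g = "\<lambda>j. (of_nat j + a) / of_nat j"
  have eq: "Q a (p - 1) = prod ?f {1..<p} * prod ?g {1..<p}"
    unfolding Q_def prod.distrib[symmetric]
    by (intro prod.cong) (auto simp: field_simps power2_eq_square)
  have mem: "?f j \<in> Z" "?g j \<in> Z" if "j \<in> {1..<p}" for j
    using that a by (auto intro!: Z_divide_less)
  have "prod ?f {1..<p} = ?f i * prod ?f ({1..<p} - {i})"
    using i by (intro prod.remove) auto
  then have f: "prod ?f {1..<p} = P * (1 / 6 / of_nat i * prod ?f ({1..<p} - {i}))"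
    by (simp add: a_def)
  have "prod ?g {1..<p} = ?g (p - i) * prod ?g ({1..<p} - {p - i})"
    using i by (intro prod.remove) auto
  also have "?g (p - i) = P * (5 / 6 / of_nat (p - i))"
    using i by (simp add: a_def of_nat_diff)
  finally have g: "prod ?g {1..<p} = P * (5 / 6 / of_nat (p - i) * prod ?g ({1..<p} - {p - i}))"
    by simp
  have "1 / 6 / of_nat i * prod ?f ({1..<p} - {i}) \<in> Z" "5 / 6 / of_nat (p - i) * prod ?g ({1..<p} - {p - i}) \<in> Z"
    using i by (intro Z_mult Z_prod Z_divide_less mem; simp)+
  then have "cg 2 (Q a (p - 1)) 0"
    unfolding eq f g by (rule cgI[OF Z_mult]) (simp add: power2_eq_square)
  then show ?thesis by (simp add: a_def)
qed

text \<open>Here \<open>a^2 = P^2 / 36\<close>, so every factor is 1 modulo p^2.\<close>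

lemma Q_cg_1:
  assumes "n < p"
  shows "cg 2 (Q (- P / 6) n) 1"
proof -
  let ?y = "\<lambda>i. - (1 / 36) / of_nat i / of_nat i :: rat"
  have y: "?y i \<in> Z" if "i \<in> {1..n}" for i
    using that assms Z_divide_6[of "1 / 6"] by (intro Z_divide_less) auto
  have "Q (- P / 6) n = (\<Prod>i=1..n. 1 + P * (P * ?y i))"
    unfolding Q_def by (intro prod.cong) (auto simp: power2_eq_square)
  also have "cg 2 \<dots> (1 + P * (\<Sum>i=1..n. P * ?y i))"
    by (intro cg_prod_first_order Z_mult y) (assumption | simp)+
  also have "cg 2 \<dots> 1"
  proof (rule cgI)
    show "(\<Sum>i=1..n. ?y i) \<in> Z" by (intro Z_sum y)
    show "1 + P * (\<Sum>i=1..n. P * ?y i) - 1 = P ^ 2 * (\<Sum>i=1..n. ?y i)"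
      unfolding sum_distrib_left[of P ?y, symmetric] by (simp only: power2_eq_square mult.assoc add_diff_cancel_left')
  qed
  finally show ?thesis .
qed

text \<open>The factors are \<open>2 (3 a \<plusminus> 1)\<close> at \<open>a = i - p/6\<close>.\<close>
lemma S_descent:
  assumes "t < p"
  shows "cg 2 ((\<Prod>i=1..t. 2 * (3 * of_nat i + 1) - P) * S (of_nat t - P / 6) p)
              ((\<Prod>i=1..t. 2 * (3 * of_nat i - 1) - P) * S (- P / 6) p)"
  using assms
proof (induction t)
  case (Suc t)
  let ?u = "\<lambda>i::nat. 2 * (3 * of_nat i + 1) - P" and ?v = "\<lambda>i::nat. 2 * (3 * of_nat i - 1) - P"
  let ?a = "of_nat (Suc t) - P / 6"
  have "?u (Suc t) * S ?a p = ?v (Suc t) * S (of_nat t - P / 6) p + 4 * Q ?a (p - 1)"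
    using S_recurrence[of ?a "p - 1"] p_gt_3 by (simp add: algebra_simps)
  also have "cg 2 \<dots> (?v (Suc t) * S (of_nat t - P / 6) p + 4 * 0)"
    using Suc.prems by (intro cg_add cg_cmult Q_cg_0) auto
  finally have "cg 2 (prod ?u {1..t} * (?u (Suc t) * S ?a p))
                  (prod ?u {1..t} * (?v (Suc t) * S (of_nat t - P / 6) p))"
    by (intro cg_cmult) auto
  also have "prod ?u {1..t} * (?v (Suc t) * S (of_nat t - P / 6) p)
      = ?v (Suc t) * (prod ?u {1..t} * S (of_nat t - P / 6) p)" by simp
  also have "cg 2 \<dots> (?v (Suc t) * (prod ?v {1..t} * S (- P / 6) p))"
    using Suc by (intro cg_cmult Z_diff Z_mult) auto
  finally show ?case by (simp add: mult_ac)
qed simp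

lemma T_base:
  assumes "0 < k"
  shows "T (- P / 6) k = P / 6 * (of_nat k - P / 6) / of_nat k ^ 2 * Q (- P / 6) (k - 1)"
  using T_Suc_eq_Q[of "- P / 6" "k - 1"] assms by (cases k) (auto simp: add.commute)

text \<open>For \<open>0 < k < p\<close> the term \<open>T\<close> has a factor p. At
  \<open>k0\<close>, the only index with p dividing \<open>3 k + 1\<close>, this factor cancels and
  an expansion modulo p^2 is needed; the other terms reduce to harmonic sums modulo p.\<close>

lemma S_base:
  assumes k0: "3 * k0 + 1 = d * p" "k0 < p" and d: "0 < d" "d < p"
  defines "D \<equiv> of_nat d"
  shows "cg 2 (S (- P / 6) p) ((2 * D - 1) * (2 + P) / (4 * D))"
proof -
  let ?b = "- P / 6" and ?A = "{1..<p} - {k0}"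
  have k0_pos: "0 < k0" using k0(1) prime_p d by (cases k0) auto
  have D: "D \<noteq> 0" "1 / D \<in> Z" using d by (auto simp: D_def intro: Z_divide_less)
  have D': "D \<in> Z" by (simp add: D_def)
  have "of_nat (3 * k0 + 1) = (of_nat (d * p) :: rat)" using k0(1) by simp
  then have rk0: "3 * of_nat k0 + 1 = D * P" by (simp add: D_def add.commute)
  have split: "{..<p} = insert 0 (insert k0 ?A)" "{..<p} - {k0} = insert 0 ?A"
    using k0 k0_pos p_gt_3 by auto
  have ndvd: "\<not> p dvd 3 * k + 1" if "k \<in> {..<p} - {k0}" for k
  proof
    assume "p dvd 3 * k + 1"
    moreover have "p dvd 3 * k0 + 1" using k0 by simp
    ultimately have "[3 * k + 1 = 3 * k0 + 1] (mod p)" by (simp only: cong_def dvd_eq_mod_eq_0)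
    then show False using three_mult_plus_one_cong_imp_eq[of k k0] that k0 by auto
  qed
  have unit: "x / (3 * of_nat k + 1) \<in> Z" if "k \<in> {..<p} - {k0}" "x \<in> Z" for k x
    using Z_divide_nat[OF ndvd] that by (simp add: add.commute)
  \<comment> \<open>To first order the term is \<open>P / 6\<close> times
    \<open>1 / (k (3 k + 1))\<close>, which is split into partial fractions.\<close>
  have rest: "cg 2 (T ?b k / (3 * of_nat k + 1)) (P * (1 / 6 * (1 / of_nat k - 3 / (3 * of_nat k + 1))))"
    if k: "k \<in> ?A" for k
  proof -
    let ?w = "1 / 6 / (3 * of_nat k + 1) / of_nat k / of_nat k :: rat"
    have w: "?w \<in> Z" using k by (intro Z_divide_less unit) auto
    have rearrange: "P * (1 / 6 / m / x / x * (y * q)) = P / 6 * y / x ^ 2 * q / m" for m x y q :: rat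
      by (cases "m = 0"; cases "x = 0") (simp_all add: field_simps power2_eq_square)
    have "cg 2 (Q ?b (k - 1)) 1" using k by (intro Q_cg_1) auto
    then obtain c where c: "c \<in> Z" "Q ?b (k - 1) = 1 + P ^ 2 * c"
      unfolding cg_def by (auto simp: algebra_simps)
    have "cg 1 ((of_nat k - P / 6) * Q ?b (k - 1)) (of_nat k)"
      using c by (intro cgI[of "of_nat k * P * c - 1 / 6 - P ^ 2 * c / 6"])
        (auto simp: algebra_simps power2_eq_square)
    then have "cg 2 (P * (?w * ((of_nat k - P / 6) * Q ?b (k - 1)))) (P * (?w * of_nat k))"
      unfolding numeral_2_eq_2 by (intro cg_P_mult cg_cmult w) simp
    also have "P * (?w * ((of_nat k - P / 6) * Q ?b (k - 1))) = T ?b k / (3 * of_nat k + 1)"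
      by (subst T_base, use k in simp, rule rearrange)
    also have "?w * of_nat k = 1 / 6 * (1 / of_nat k - 3 / (3 * of_nat k + 1))"
      using k by (simp add: divide_simps)
    finally show ?thesis .
  qed
  have "(\<Sum>k=1..<p. 1 / of_nat k) = 1 / of_nat k0 + (\<Sum>k\<in>?A. 1 / of_nat k :: rat)"
    by (rule sum.remove) (use k0 k0_pos in auto)
  with sum_inverse_cg_0 have h0: "cg 1 (1 / of_nat k0 + (\<Sum>k\<in>?A. 1 / of_nat k)) 0"
    by simp
  have "cg 1 (1 / of_nat k0) (- 3)"
  proof (rule cgI[of "D / of_nat k0"])
    show "D / of_nat k0 \<in> Z" using k0 k0_pos D' by (intro Z_divide_less) auto
    have "1 / of_nat k0 - - 3 = (3 * of_nat k0 + 1) / (of_nat k0 :: rat)"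
      using k0_pos by (simp add: field_simps)
    then show "1 / of_nat k0 - - 3 = P ^ 1 * (D / of_nat k0)" unfolding rk0 by simp
  qed
  from cg_diff[OF h0 this] have h1: "cg 1 (\<Sum>k\<in>?A. 1 / of_nat k) 3"
    by simp
  \<comment> \<open>Away from \<open>k0\<close>, the values \<open>3 k + 1\<close> run through all
    nonzero residues, so their reciprocals sum to 0 modulo p. Splitting off \<open>k = 0\<close>
    leaves -1 over \<open>?A\<close>.\<close>
  have "bij_betw (\<lambda>k. (3 * k + 1) mod p) ({..<p} - {k0}) {1..<p}"
  proof -
    have inj: "inj_on (\<lambda>k. (3 * k + 1) mod p) ({..<p} - {k0})"
      by (intro inj_onI three_mult_plus_one_cong_imp_eq) (simp_all add: cong_def)
    have sub: "(\<lambda>k. (3 * k + 1) mod p) ` ({..<p} - {k0}) \<subseteq> {1..<p}"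
    proof (intro image_subsetI)
      fix k assume "k \<in> {..<p} - {k0}"
      from ndvd[OF this] have "(3 * k + 1) mod p \<noteq> 0" by (simp only: dvd_eq_mod_eq_0) simp
      then show "(3 * k + 1) mod p \<in> {1..<p}" using p_gt_3 by (simp add: Suc_le_eq)
    qed
    have "(\<lambda>k. (3 * k + 1) mod p) ` ({..<p} - {k0}) = {1..<p}"
    proof (rule card_subset_eq[OF _ sub])
      show "card ((\<lambda>k. (3 * k + 1) mod p) ` ({..<p} - {k0})) = card {1..<p}"
        unfolding card_image[OF inj] using k0 by simp
    qed simp
    then show ?thesis using inj by (simp add: bij_betw_def)
  qed
  then have eq: "(\<Sum>k=1..<p. 1 / of_nat k) = (\<Sum>k\<in>{..<p} - {k0}. 1 / (of_nat ((3 * k + 1) mod p) :: rat))"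
    by (rule sum.reindex_bij_betw[symmetric])
  have "cg 1 (\<Sum>k\<in>{..<p} - {k0}. 1 / of_nat ((3 * k + 1) mod p)) (\<Sum>k\<in>{..<p} - {k0}. 1 / (3 * of_nat k + 1))"
  proof (intro cg_sum cg_inverse)
    fix k assume k: "k \<in> {..<p} - {k0}"
    have pos: "0 < (3 * k + 1) mod p" using ndvd[OF k] by (simp only: dvd_eq_mod_eq_0)
    then show "(of_nat ((3 * k + 1) mod p) :: rat) \<noteq> 0" by simp
    show "1 / of_nat ((3 * k + 1) mod p) \<in> Z" using pos p_gt_3 by (intro Z_divide_less) auto
    show "1 / (3 * of_nat k + 1) \<in> Z" using k by (intro unit) auto
    show "cg 1 (of_nat ((3 * k + 1) mod p)) (3 * of_nat k + 1)"
      using cg_of_nat_mod[of "3 * k + 1"] by (simp add: add.commute)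
  qed simp
  from cg_trans[OF cg_sym[OF this] sum_inverse_cg_0[unfolded eq]]
  have "cg 1 (1 + (\<Sum>k\<in>?A. 1 / (3 * of_nat k + 1))) 0"
    unfolding split(2) by simp
  then have h2: "cg 1 (\<Sum>k\<in>?A. 1 / (3 * of_nat k + 1)) (- 1)"
    unfolding cg_def by (simp add: algebra_simps)
  have "cg 1 (1 / 6 * ((\<Sum>k\<in>?A. 1 / of_nat k) - 3 * (\<Sum>k\<in>?A. 1 / (3 * of_nat k + 1)))) (1 / 6 * (3 - 3 * (- 1)))"
    by (intro cg_cmult cg_diff h1 h2) auto
  moreover have "1 / 6 * ((\<Sum>k\<in>?A. 1 / of_nat k) - 3 * (\<Sum>k\<in>?A. 1 / (3 * of_nat k + 1)))
      = (\<Sum>k\<in>?A. 1 / 6 * (1 / of_nat k - 3 / (3 * of_nat k + 1)) :: rat)"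
    by (simp only: sum_distrib_left sum_subtractf[symmetric]) simp
  ultimately have "cg 1 (\<Sum>k\<in>?A. 1 / 6 * (1 / of_nat k - 3 / (3 * of_nat k + 1))) 1"
    by simp
  from cg_P_mult[OF this]
  have s0: "cg 2 (\<Sum>k\<in>?A. P * (1 / 6 * (1 / of_nat k - 3 / (3 * of_nat k + 1)))) P"
    by (simp only: numeral_2_eq_2 One_nat_def sum_distrib_left mult_1_right)
  have "cg 2 (\<Sum>k\<in>?A. T ?b k / (3 * of_nat k + 1)) (\<Sum>k\<in>?A. P * (1 / 6 * (1 / of_nat k - 3 / (3 * of_nat k + 1))))"
    by (intro cg_sum rest)
  from cg_trans[OF this s0] have s1: "cg 2 (\<Sum>k\<in>?A. T ?b k / (3 * of_nat k + 1)) P" .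
  let ?w = "1 / 6 / of_nat k0 / of_nat k0 * (1 / D) * (of_nat k0 - P / 6)"
  have s2: "cg 2 (T ?b k0 / (3 * of_nat k0 + 1)) (- (1 / (2 * D)) * (1 + D * P + P / 2))"
  proof -
    have w: "?w \<in> Z" using k0 k0_pos D by (intro Z_mult Z_divide_less) auto
    have "T ?b k0 / (3 * of_nat k0 + 1) = ?w * Q ?b (k0 - 1)"
      unfolding rk0 using k0_pos D by (subst T_base) (auto simp: power2_eq_square)
    also have "cg 2 \<dots> (?w * 1)" using k0 by (intro cg_cmult w Q_cg_1) auto
    \<comment> \<open>Since \<open>k0 = (D * P - 1) / 3\<close>, one has
      \<open>1 / k0 = - 3 (1 + D * P)\<close> modulo p^2. The witness \<open>?c\<close> is the exact
      remainder once the constant and linear terms in \<open>P\<close> cancel.\<close>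
    also have "cg 2 (?w * 1) (- (1 / (2 * D)) * (1 + D * P + P / 2))"
    proof (rule cgI)
      let ?c = "1 / 9 * (1 / D) / 2 * (- 2 * D * (D + 1 / 2) + D ^ 2 * (1 + D * P + P / 2)) / of_nat k0 / of_nat k0"
      have "1 / 9 \<in> Z" using Z_divide_3[of "1 / 3"] by simp
      then show "?c \<in> Z" using k0 k0_pos D D' by (intro Z_divide_less Z_mult Z_divide_2) auto
      have k: "of_nat k0 = (D * P - 1) / 3" using rk0 by (simp add: field_simps)
      have "D * P - 1 \<noteq> 0" using k k0_pos by auto
      then show "?w * 1 - - (1 / (2 * D)) * (1 + D * P + P / 2) = P ^ 2 * ?c"
        unfolding k using D(1) by (simp add: divide_simps) (simp add: algebra_simps power2_eq_square)
    qed
    finally show ?thesis .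
  qed
  have "S ?b p = 1 + (T ?b k0 / (3 * of_nat k0 + 1) + (\<Sum>k\<in>?A. T ?b k / (3 * of_nat k + 1)))"
    unfolding S_def split(1)
    by (subst sum.insert, simp, use k0_pos in simp, subst sum.insert) (simp_all add: T_def[of _ 0])
  also have "cg 2 \<dots> (1 + (- (1 / (2 * D)) * (1 + D * P + P / 2) + P))"
    by (intro cg_add s1 s2 cg_refl)
  also have "\<dots> = (2 * D - 1) * (2 + P) / (4 * D)"
    using D(1) by (simp add: field_simps)
  finally show ?thesis .
qed

section \<open>Halving on the half system, as in Gauss's lemma\<close>

definition H :: "nat set \<Rightarrow> rat" where
  "H A = (\<Sum>c\<in>A. 1 / of_nat c)"

text \<open>Twice \<open>halve c\<close> is \<open>c\<close> or \<open>p - c\<close>, whichever is even.\<close>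
definition halve :: "nat \<Rightarrow> nat" where
  "halve c = (if even c then c div 2 else (p - c) div 2)"

lemma odd_p: "odd p"
  using prime_p p_gt_3 prime_odd_nat by auto

abbreviation half :: "nat set" where "half \<equiv> {1..(p - 1) div 2}"

lemma less_p_if_half: "c \<in> half \<Longrightarrow> 0 < c \<and> c < p \<and> 2 * c < p"
  by auto

lemma Z_divide_half: "c \<in> half \<Longrightarrow> x \<in> Z \<Longrightarrow> x / of_nat c \<in> Z"
  by (intro Z_divide_less) auto

lemma double_halve: "c \<in> half \<Longrightarrow> 2 * halve c = (if even c then c else p - c)"
  using odd_p by (auto simp: halve_def)

lemma of_nat_double_halve:
  "c \<in> half \<Longrightarrow> 2 * of_nat (halve c) = (if even c then of_nat c else P - of_nat c)"
  using double_halve[of c] less_p_if_half[of c]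
  by (metis (mono_tags, lifting) less_imp_le of_nat_diff of_nat_mult of_nat_numeral)

lemma halve_in_half: "c \<in> half \<Longrightarrow> halve c \<in> half"
  using double_halve[of c] odd_p by (auto split: if_splits)

text \<open>Equal images force \<open>c = d\<close> or \<open>c + d = p\<close>; the latter is
  impossible because \<open>2 c < p\<close> and \<open>2 d < p\<close>.\<close>

lemma inj_halve: "inj_on halve half"
proof (rule inj_onI)
  fix c d assume *: "c \<in> half" "d \<in> half" "halve c = halve d"
  then have "(if even c then c else p - c) = (if even d then d else p - d)"
    using double_halve by metis
  then show "c = d" using * odd_p by (auto split: if_splits)
qed

lemma bij_halve: "bij_betw halve half half"
  unfolding bij_betw_def
  by (intro conjI inj_halve endo_inj_surj) (auto simp only: finite_atLeastAtMost halve_in_half)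

lemma bij_halve_subset:
  assumes "A \<subseteq> half" "B \<subseteq> half" "\<And>c. c \<in> half \<Longrightarrow> halve c \<in> B \<longleftrightarrow> c \<in> A"
  shows "bij_betw halve A B"
proof -
  have "inj_on halve A" using inj_halve assms(1) by (rule inj_on_subset)
  moreover have "halve ` A = B"
  proof (intro equalityI subsetI)
    fix b assume "b \<in> B"
    moreover from this assms(2) bij_halve obtain c where "c \<in> half" "b = halve c"
      unfolding bij_betw_def by (metis imageE subsetD)
    ultimately show "b \<in> halve ` A" using assms(3) by simp
  next
    fix b assume "b \<in> halve ` A"
    then obtain c where "c \<in> A" "b = halve c" by (rule imageE)
    moreover from this assms(1) have "c \<in> half" by (rule_tac subsetD)
    ultimately show "b \<in> B" using assms(3) by simp
  qed
  ultimately show ?thesis by (simp add: bij_betw_def)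
qed

lemma H_mem [simp]: "A \<subseteq> half \<Longrightarrow> H A \<in> Z"
  unfolding H_def by (intro Z_sum Z_divide_half) auto

text \<open>For odd \<open>c\<close>, \<open>p - c\<close> is \<open>- c\<close> modulo p, so
  doubling the halved element only introduces a sign.\<close>

lemma inverse_halve_cg:
  assumes "c \<in> half"
  shows "cg 1 (1 / (2 * of_nat (halve c))) ((- 1) ^ c / of_nat c)"
proof (cases "even c")
  case True
  then show ?thesis by (simp add: of_nat_double_halve[OF assms])
next
  case False
  have c: "0 < c" "c < p" using assms by auto
  have "cg 1 (1 / of_nat (p - c)) (1 / (- of_nat c))"
  proof (rule cg_inverse)
    show "1 / of_nat (p - c) \<in> Z" using c by (intro Z_divide_less) auto
    show "1 / - of_nat c \<in> Z" using c Z_uminus[OF Z_divide_less[of c 1]] by simp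
    show "cg 1 (of_nat (p - c)) (- of_nat c)" using c by (intro cgI[of 1]) (auto simp: of_nat_diff)
  qed (use c in auto)
  then show ?thesis using False c by (simp add: of_nat_double_halve[OF assms] of_nat_diff)
qed

text \<open>Gauss's lemma refined to modulus p^2: \<open>2 * halve c\<close> is
  \<open>(- 1) ^ c * c\<close>, with a correction \<open>1 - P / c\<close> for odd
  \<open>c\<close>.\<close>

lemma prod_halve_cg:
  assumes A: "A \<subseteq> half" and bij: "bij_betw halve A B" and B: "B \<subseteq> half"
  shows "cg 2 (2 ^ card A * (\<Prod>c\<in>B. of_nat c))
              ((\<Prod>c\<in>A. (- 1) ^ c) * (\<Prod>c\<in>A. of_nat c) * (1 - P * (H A / 2 - H B / 4)))"
proof -
  have fin: "finite A" using A finite_subset by blast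
  let ?y = "\<lambda>c. if even c then 0 else - (1 / of_nat c) :: rat"
  have y: "?y c \<in> Z" if "c \<in> A" for c
    using that A Z_divide_half[of c 1] by auto
  have "(\<Prod>c\<in>B. of_nat c) = (\<Prod>c\<in>A. of_nat (halve c) :: rat)"
    using bij by (rule prod.reindex_bij_betw[symmetric])
  then have "2 ^ card A * (\<Prod>c\<in>B. of_nat c) = (\<Prod>c\<in>A. 2 * of_nat (halve c) :: rat)"
    by (simp add: prod.distrib)
  also have "\<dots> = (\<Prod>c\<in>A. (- 1) ^ c * of_nat c * (1 + P * ?y c))"
  proof (rule prod.cong[OF refl])
    fix c assume "c \<in> A"
    then have c: "c \<in> half" using A by blast
    then have "c > 0" by simp
    then show "2 * of_nat (halve c) = (- 1) ^ c * of_nat c * (1 + P * ?y c)"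
      by (simp add: of_nat_double_halve[OF c] field_simps)
  qed
  also have "\<dots> = (\<Prod>c\<in>A. (- 1) ^ c) * (\<Prod>c\<in>A. of_nat c) * (\<Prod>c\<in>A. 1 + P * ?y c)"
    by (simp only: prod.distrib)
  also have "cg 2 \<dots> ((\<Prod>c\<in>A. (- 1) ^ c) * (\<Prod>c\<in>A. of_nat c) * (1 + P * (\<Sum>c\<in>A. ?y c)))"
    by (intro cg_cmult cg_prod_first_order fin y Z_mult Z_prod) simp_all
  also have "cg 2 \<dots> ((\<Prod>c\<in>A. (- 1) ^ c) * (\<Prod>c\<in>A. of_nat c) * (1 + P * (H B / 4 - H A / 2)))"
  \<comment> \<open>The corrections sum over the odd elements only. Comparing \<open>H B / 2\<close>
    with the signed harmonic sum over \<open>A\<close> expresses this sum modulo p by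
    \<open>H A\<close> and \<open>H B\<close>.\<close>
  proof -
    have "H B / 2 = (\<Sum>c\<in>A. 1 / (2 * of_nat (halve c)))"
      unfolding H_def sum.reindex_bij_betw[OF bij, symmetric] by (simp add: sum_divide_distrib mult.commute)
    also have "cg 1 \<dots> (\<Sum>c\<in>A. (- 1) ^ c / of_nat c)"
      using A by (intro cg_sum inverse_halve_cg) auto
    also have "(\<Sum>c\<in>A. (- 1) ^ c / of_nat c) = (\<Sum>c\<in>A. 1 / of_nat c + 2 * ?y c)"
      by (intro sum.cong) auto
    also have "\<dots> = H A + 2 * (\<Sum>c\<in>A. ?y c)"
      by (simp only: sum.distrib sum_distrib_left H_def)
    finally have "cg 1 (H B / 2) (H A + 2 * (\<Sum>c\<in>A. ?y c))" .
    from cg_sym[OF cg_cmult[OF _ cg_diff[OF this cg_refl[of _ "H A"]], of "1 / 2"]]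
    have "cg 1 (\<Sum>c\<in>A. ?y c) (H B / 4 - H A / 2)"
      by (simp add: algebra_simps)
    from cg_P_mult[OF this] show ?thesis
      unfolding numeral_2_eq_2 One_nat_def
      by (intro cg_cmult[OF _ cg_add] cg_refl Z_mult Z_prod) simp_all
  qed
  finally show ?thesis by (simp add: algebra_simps)
qed

section \<open>Products over the residue classes modulo 3 in the half system\<close>

abbreviation cls :: "nat \<Rightarrow> nat set" where "cls k \<equiv> {c \<in> half. c mod 3 = k}"
abbreviation U :: "nat \<Rightarrow> rat" where "U k \<equiv> (\<Prod>c\<in>cls k. P - 2 * of_nat c)"

lemma U_cg:
  "cg 2 (U k) ((- 2) ^ card (cls k) * (\<Prod>c\<in>cls k. of_nat c) * (1 - P * (H (cls k) / 2)))"
proof -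
  let ?K = "(- 2) ^ card (cls k) * (\<Prod>c\<in>cls k. of_nat c) :: rat"
  define y where "y c = - (1 / of_nat c / 2 :: rat)" for c :: nat
  have y: "y c \<in> Z" if "c \<in> cls k" for c
    unfolding y_def using that by (intro Z_uminus Z_divide_2 Z_divide_half) auto
  have sum: "(\<Sum>c\<in>cls k. y c) = - (H (cls k) / 2)"
    unfolding y_def H_def sum_negf sum_divide_distrib ..
  have "U k = (\<Prod>c\<in>cls k. - 2 * of_nat c * (1 + P * y c))"
  proof (rule prod.cong[OF refl])
    fix c assume "c \<in> cls k"
    then have "c \<noteq> 0" by auto
    then show "P - 2 * of_nat c = - 2 * of_nat c * (1 + P * y c)"
      by (simp add: y_def right_diff_distrib)
  qed
  then have "U k = ?K * (\<Prod>c\<in>cls k. 1 + P * y c)"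
    by (simp only: prod.distrib prod_constant)
  moreover have "?K \<in> Z" by (intro Z_mult Z_power Z_prod) simp_all
  then have "cg 2 (?K * (\<Prod>c\<in>cls k. 1 + P * y c)) (?K * (1 + P * (\<Sum>c\<in>cls k. y c)))"
    by (intro cg_cmult cg_prod_first_order y) simp_all
  ultimately show ?thesis
    unfolding sum by (simp only: mult_minus_right diff_conv_add_uminus)
qed

lemma p_mod_3: "p mod 3 = 1 \<or> p mod 3 = 2"
proof -
  have "\<not> 3 dvd p" using prime_p p_gt_3 by (auto simp: prime_nat_iff)
  then show ?thesis by presburger
qed

lemma inverse_prod_Z:
  assumes "\<And>i. i \<in> A \<Longrightarrow> 1 / f i \<in> Z"
  shows "1 / prod f A \<in> Z"
  using Z_prod[of A "\<lambda>i. 1 / f i"] assms by (simp add: prod_dividef)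

text \<open>Apply \<open>prod_halve_cg\<close> to the whole half system: the product cancels, and
  squaring removes the sign.\<close>

lemma power_2_cg: "cg 2 (2 ^ (p - 1)) (1 - P * (H half / 2))"
proof -
  let ?pr = "\<Prod>c\<in>half. of_nat c :: rat" and ?s = "\<Prod>c\<in>half. (- 1) ^ c :: rat" and ?x = "1 - P * (H half / 4)"
  have pr: "1 / ?pr \<in> Z" "?pr \<noteq> 0" using Z_divide_half by (auto intro!: inverse_prod_Z)
  have s: "?s * ?s = 1"
    by (simp flip: prod.distrib power_mult_distrib)
  have Z: "?s * ?x \<in> Z" "?pr \<in> Z" "?s \<in> Z" by (intro Z_mult Z_diff Z_prod; simp)+
  have "cg 2 (2 ^ card half * ?pr) (?s * ?pr * (1 - P * (H half / 2 - H half / 4)))"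
    by (intro prod_halve_cg bij_halve) auto
  then have "cg 2 (?pr * 2 ^ card half) (?pr * (?s * ?x))"
    by (simp add: mult_ac)
  then have *: "cg 2 (2 ^ card half) (?s * ?x)" by (rule cg_cancel[OF pr])
  have "cg 2 (2 ^ card half * 2 ^ card half) (?s * ?x * (?s * ?x))"
    by (intro cg_mult * Z) simp
  moreover have "2 ^ card half * 2 ^ card half = (2 ^ (p - 1) :: rat)"
    using odd_p by (simp flip: power_add mult_2)
  moreover have "?s * ?x * (?s * ?x) = (?s * ?s) * (?x * ?x)" by (simp only: mult_ac)
  ultimately have "cg 2 (2 ^ (p - 1)) (?x * ?x)" by (simp only: s mult_1_left)
  also have "cg 2 (?x * ?x) (1 - P * (H half / 2))"
    by (intro cgI[of "H half ^ 2 / 4 / 4"] Z_divide_4 Z_power H_mem) (auto simp: algebra_simps power2_eq_square)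
  finally show ?thesis .
qed

text \<open>Since 2 is its own inverse modulo 3, \<open>halve c\<close> is congruent to
  \<open>2 c\<close> for even \<open>c\<close> and to \<open>2 (p - c)\<close> for odd
  \<open>c\<close>. In particular, class \<open>s\<close> goes to class \<open>r\<close> for either
  parity.\<close>

lemma halve_mod_3:
  assumes "c \<in> half" and r: "r = p mod 3" and s: "s = 3 - r"
  shows "halve c mod 3 = (if even c then 2 * (c mod 3) mod 3 else if c mod 3 = 0 then s else if c mod 3 = s then r else 0)"
proof -
  have eq: "(2 * h + d) mod 3 = (2 * (h mod 3) + d mod 3) mod 3" for h d :: nat
    by (intro mod_add_cong) (simp_all add: mod_mult_right_eq)
  have cases: "x mod 3 = 0 \<or> x mod 3 = 1 \<or> x mod 3 = 2" for x :: nat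
    by linarith
  show ?thesis
  proof (cases "even c")
    case True
    have "2 * halve c + 0 = c" unfolding double_halve[OF assms(1)] using True by simp
    then have "c mod 3 = 2 * (halve c mod 3) mod 3" using eq[of "halve c" 0] by simp
    with cases[of "halve c"] have "halve c mod 3 = 2 * (c mod 3) mod 3" by auto
    then show ?thesis using True by simp
  next
    case False
    have "2 * halve c + c = p"
      unfolding double_halve[OF assms(1)] using False less_p_if_half[OF assms(1)] by simp
    with eq[of "halve c" c] have "r = (2 * (halve c mod 3) + c mod 3) mod 3" by (simp only: r)
    then show ?thesis
      using cases[of "halve c"] cases[of c] p_mod_3 False unfolding s r[symmetric]
      by (elim disjE) simp_all
  qed
qed

text \<open>Halving maps \<open>?D\<close> onto \<open>?E\<close>; cancelling the common class 0
  compares the products over \<open>r\<close> and \<open>s\<close>. A linear relation modulo p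
  between the three harmonic sums then lets \<open>power_2_cg\<close> absorb the first-order
  terms.\<close>

lemma class_prod_cg:
  assumes r: "r = p mod 3" and s: "s = 3 - r"
    and sign: "(\<Prod>c\<in>{c \<in> half. c mod 3 \<noteq> s}. (- 1) ^ c) = (1 :: rat)"
  shows "cg 2 (3 * 2 ^ card {c \<in> half. c mod 3 \<noteq> s} * U s) ((2 ^ (p - 1) + 2) * U r)"
proof -
  let ?D = "{c \<in> half. c mod 3 \<noteq> s}" and ?E = "{c \<in> half. c mod 3 \<noteq> r}"
  let ?pr = "\<lambda>A. \<Prod>c\<in>A. of_nat c :: rat"
  have rs: "r = 1 \<and> s = 2 \<or> r = 2 \<and> s = 1" using p_mod_3 r s by auto
  have disj: "cls 0 \<inter> cls r = {}" "cls 0 \<inter> cls s = {}" "?D \<inter> cls s = {}" using rs by auto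
  have cases: "c mod 3 = 0 \<or> c mod 3 = 1 \<or> c mod 3 = 2" for c :: nat by linarith
  have DE: "?D = cls 0 \<union> cls r" "?E = cls 0 \<union> cls s" "?D \<union> cls s = half"
    using rs cases by auto
  have HU: "H (A \<union> B) = H A + H B" and prU: "?pr (A \<union> B) = ?pr A * ?pr B"
    if "A \<inter> B = {}" "finite A" "finite B" for A B
    unfolding H_def using that by (simp_all add: sum.union_disjoint prod.union_disjoint)
  have iff: "halve c mod 3 = r \<longleftrightarrow> c mod 3 = s" if "c \<in> half" for c
    unfolding halve_mod_3[OF that r s] using rs cases[of c] by (elim disjE) auto
  have bij: "bij_betw halve ?D ?E" "bij_betw halve (cls s) (cls r)"
    by (intro bij_halve_subset; use iff halve_in_half in auto)+
  have H: "H ?D = H (cls 0) + H (cls r)" "H ?E = H (cls 0) + H (cls s)"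
    unfolding DE(1,2) using disj by (intro HU; simp)+
  have Hh: "H half = H ?D + H (cls s)"
    using HU[OF disj(3)] DE(3) by simp
  have pr: "?pr ?D = ?pr (cls 0) * ?pr (cls r)" "?pr ?E = ?pr (cls 0) * ?pr (cls s)"
    unfolding DE(1,2) using disj by (intro prU; simp)+
  have HZ: "H (cls k) \<in> Z" for k by (rule H_mem) auto
  have prZ: "?pr (cls k) \<in> Z" for k by (intro Z_prod) simp
  have pr0: "1 / ?pr (cls 0) \<in> Z" "?pr (cls 0) \<noteq> 0"
    using Z_divide_half by (auto intro!: inverse_prod_Z)

  \<comment> \<open>Modulo \<open>p\<close>, the weighted sum over \<open>?D\<close> is the sum of \<open>1 / m\<close> over all multiples \<open>m < p\<close> of 3:
    the elements of \<open>cls r\<close> stand for \<open>m = p - c\<close>. The sum over \<open>?E\<close> splits the same \<open>m\<close> by parity.\<close>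
  define \<chi> where "\<chi> c = (if c mod 3 = 0 then 1 else - 1 :: rat)" for c :: nat
  have \<chi>: "\<chi> c \<in> Z" for c by (simp add: \<chi>_def)
  have \<chi>_class: "c \<in> cls 0 \<Longrightarrow> \<chi> c = 1" "c \<in> cls r \<Longrightarrow> \<chi> c = - 1" "c \<in> cls s \<Longrightarrow> \<chi> c = - 1" for c
    using rs by (auto simp: \<chi>_def)
  \<comment> \<open>On \<open>?D\<close>, the value of \<open>\<chi>\<close> changes under
    \<open>halve\<close> exactly when \<open>c\<close> is odd, which compensates the sign.\<close>
  have \<chi>_halve: "\<chi> (halve c) * ((- 1) ^ c / of_nat c) = \<chi> c * (1 / of_nat c)" if c: "c \<in> ?D" for c
  proof -
    from c have half: "c \<in> half" by simp
    have "\<chi> (halve c) * (- 1) ^ c = \<chi> c"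
      unfolding \<chi>_def halve_mod_3[OF half r s] using rs c cases[of c] by (cases "even c") auto
    then show ?thesis by (metis mult_1_right times_divide_eq_right)
  qed
  have sumE: "(\<Sum>c\<in>?E. \<chi> c * (1 / (2 * of_nat c))) = (H (cls 0) - H (cls s)) / 2"
  proof -
    have "(\<Sum>c\<in>?E. \<chi> c * (1 / (2 * of_nat c)))
        = (\<Sum>c\<in>cls 0. \<chi> c * (1 / (2 * of_nat c))) + (\<Sum>c\<in>cls s. \<chi> c * (1 / (2 * of_nat c)))"
      unfolding DE(2) using disj by (intro sum.union_disjoint) simp_all
    moreover have "(\<Sum>c\<in>cls 0. \<chi> c * (1 / (2 * of_nat c))) = (\<Sum>c\<in>cls 0. 1 / of_nat c / 2)"
      by (intro sum.cong refl) (simp add: \<chi>_class del: mem_Collect_eq)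
    moreover have "(\<Sum>c\<in>cls s. \<chi> c * (1 / (2 * of_nat c))) = (\<Sum>c\<in>cls s. - (1 / of_nat c / 2))"
      by (intro sum.cong refl) (simp add: \<chi>_class del: mem_Collect_eq)
    moreover have "a / 2 + - (b / 2) = (a - b) / 2" for a b :: rat
      by (simp add: diff_divide_distrib)
    ultimately show ?thesis
      by (simp only: H_def sum_negf sum_divide_distrib[symmetric])
  qed
  have sumD: "(\<Sum>c\<in>?D. \<chi> c * (1 / of_nat c)) = H (cls 0) - H (cls r)"
  proof -
    have "(\<Sum>c\<in>?D. \<chi> c * (1 / of_nat c))
        = (\<Sum>c\<in>cls 0. \<chi> c * (1 / of_nat c)) + (\<Sum>c\<in>cls r. \<chi> c * (1 / of_nat c))"
      unfolding DE(1) using disj by (intro sum.union_disjoint) simp_all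
    moreover have "(\<Sum>c\<in>cls 0. \<chi> c * (1 / of_nat c)) = (\<Sum>c\<in>cls 0. 1 / of_nat c)"
      by (intro sum.cong refl) (simp add: \<chi>_class del: mem_Collect_eq)
    moreover have "(\<Sum>c\<in>cls r. \<chi> c * (1 / of_nat c)) = (\<Sum>c\<in>cls r. - (1 / of_nat c))"
      by (intro sum.cong refl) (simp add: \<chi>_class del: mem_Collect_eq)
    ultimately show ?thesis
      by (simp only: H_def sum_negf)
  qed
  have "cg 1 (\<Sum>c\<in>?D. \<chi> (halve c) * (1 / (2 * of_nat (halve c)))) (\<Sum>c\<in>?D. \<chi> (halve c) * ((- 1) ^ c / of_nat c))"
    by (intro cg_sum cg_cmult inverse_halve_cg \<chi>) simp
  moreover have "(\<Sum>c\<in>?D. \<chi> (halve c) * ((- 1) ^ c / of_nat c)) = (\<Sum>c\<in>?D. \<chi> c * (1 / of_nat c))"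
    by (intro sum.cong refl \<chi>_halve)
  moreover have "(\<Sum>c\<in>?E. \<chi> c * (1 / (2 * of_nat c))) = (\<Sum>c\<in>?D. \<chi> (halve c) * (1 / (2 * of_nat (halve c))))"
    using bij(1) by (rule sum.reindex_bij_betw[symmetric])
  ultimately have "cg 1 ((H (cls 0) - H (cls s)) / 2) (H (cls 0) - H (cls r))"
    by (simp only: sumE sumD)
  then obtain e where e: "e \<in> Z" "(H (cls 0) - H (cls s)) / 2 - (H (cls 0) - H (cls r)) = P * e"
    unfolding cg_def by auto

  define D K pr_r pr_s h0 hr hs where
    "D = card ?D" and "K = (- 2 :: rat) ^ card (cls s)" and "pr_r = ?pr (cls r)" and "pr_s = ?pr (cls s)"
    and "h0 = H (cls 0)" and "hr = H (cls r)" and "hs = H (cls s)"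
  note defs = this
  define x where "x = (h0 + hr) / 2 - (h0 + hs) / 4"
  have Z: "h0 \<in> Z" "hr \<in> Z" "hs \<in> Z" "pr_r \<in> Z" "x \<in> Z" "K \<in> Z"
    unfolding defs x_def by (intro Z_add Z_diff Z_divide_2 Z_divide_4 HZ prZ Z_power; simp)+
  have "cg 2 (2 ^ card ?D * ?pr ?E) ((\<Prod>c\<in>?D. (- 1) ^ c) * ?pr ?D * (1 - P * (H ?D / 2 - H ?E / 4)))"
    by (intro prod_halve_cg bij(1)) auto
  then have "cg 2 (2 ^ D * (?pr (cls 0) * pr_s)) (1 * (?pr (cls 0) * pr_r) * (1 - P * x))"
    unfolding sign pr H defs x_def .
  then have "cg 2 (?pr (cls 0) * (2 ^ D * pr_s)) (?pr (cls 0) * (pr_r * (1 - P * x)))"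
    by (simp only: mult_ac mult_1_left)
  then have f: "cg 2 (2 ^ D * pr_s) (pr_r * (1 - P * x))"
    by (rule cg_cancel[OF pr0])
  have Us: "cg 2 (U s) (K * pr_s * (1 - P * (hs / 2)))"
    using U_cg[of s] unfolding defs .
  have Ur: "cg 2 (U r) (K * pr_r * (1 - P * (hr / 2)))"
    using U_cg[of r] bij_betw_same_card[OF bij(2)] unfolding defs by (simp only:)
  have W: "cg 2 (2 ^ (p - 1) + 2) (3 - P * ((h0 + hr + hs) / 2))"
    using cg_add[OF power_2_cg cg_refl[of 2 2]] unfolding Hh H defs
    by (simp only: diff_add_eq add.commute[of _ 2] add_diff_eq) simp
  have h0: "h0 = 2 * hr - hs - 2 * P * e"
    using e(2) unfolding defs[symmetric] by (simp add: field_simps)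
  \<comment> \<open>The coefficients of \<open>P\<close> differ by
    \<open>(2 hr - hs - h0) / 4 = P * e / 2\<close>; the rest of the witness comes from products of
    first-order terms.\<close>
  have first_order: "cg 2 (3 * (1 - P * (hs / 2)) * (1 - P * x)) ((3 - P * ((h0 + hr + hs) / 2)) * (1 - P * (hr / 2)))"
  proof (rule cgI)
    show "e / 2 + 3 * (hs / 2) * x - (h0 + hr + hs) / 2 * (hr / 2) \<in> Z"
      using Z e(1) by simp
    show "3 * (1 - P * (hs / 2)) * (1 - P * x) - (3 - P * ((h0 + hr + hs) / 2)) * (1 - P * (hr / 2))
        = P ^ 2 * (e / 2 + 3 * (hs / 2) * x - (h0 + hr + hs) / 2 * (hr / 2))"
      unfolding x_def h0 by (simp add: field_simps power2_eq_square)
  qed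
  have "cg 2 (3 * 2 ^ D * U s) (3 * 2 ^ D * (K * pr_s * (1 - P * (hs / 2))))"
    by (intro cg_cmult Us) simp
  also have "\<dots> = 3 * K * (1 - P * (hs / 2)) * (2 ^ D * pr_s)"
    by (simp only: mult_ac)
  also have "cg 2 \<dots> (3 * K * (1 - P * (hs / 2)) * (pr_r * (1 - P * x)))"
    using Z by (intro cg_cmult f Z_mult Z_diff Z_divide_2) simp_all
  also have "\<dots> = K * pr_r * (3 * (1 - P * (hs / 2)) * (1 - P * x))"
    by (simp only: mult_ac)
  also have "cg 2 \<dots> (K * pr_r * ((3 - P * ((h0 + hr + hs) / 2)) * (1 - P * (hr / 2))))"
    using Z by (intro cg_cmult first_order Z_mult)
  also have "\<dots> = (3 - P * ((h0 + hr + hs) / 2)) * (K * pr_r * (1 - P * (hr / 2)))"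
    by (simp only: mult_ac)
  also have "cg 2 \<dots> ((2 ^ (p - 1) + 2) * U r)"
  proof (rule cg_mult[OF _ _ cg_sym[OF W] cg_sym[OF Ur]])
    show "U r \<in> Z" by (intro Z_prod) simp
  qed (use Z in simp)
  finally show ?thesis unfolding D_def .
qed

section \<open>Evaluation at -1/6 for \<open>p = 6 t + 1\<close> and
  \<open>p = 6 t + 5\<close>\<close>

text \<open>Each factor is an odd integer, hence nonzero, of absolute value below p.\<close>

lemma factor_unit:
  assumes "6 * t < 2 * p - 2" "i \<in> {1..t}"
  shows "1 / (2 * (3 * of_nat i + 1) - P) \<in> Z" "2 * (3 * of_nat i + 1) - P \<noteq> 0"
proof -
  let ?b = "2 * (3 * int i + 1) - int p"
  have eq: "2 * (3 * of_nat i + 1) - P = of_int ?b" by simp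
  have "?b \<noteq> 0" using odd_p by presburger
  moreover have "\<bar>?b\<bar> < int p" using assms by auto
  ultimately have "\<not> int p dvd ?b" using zdvd_imp_le[of "int p" "\<bar>?b\<bar>"] by auto
  then show "1 / (2 * (3 * of_nat i + 1) - P) \<in> Z" unfolding eq by (intro Z_divide_int) simp_all
  show "2 * (3 * of_nat i + 1) - P \<noteq> 0" unfolding eq of_int_eq_0_iff by fact
qed

text \<open>\<open>v t / u t\<close> is the factor collected in the descent from \<open>t - p/6\<close> to \<open>-p/6\<close>.\<close>
abbreviation u :: "nat \<Rightarrow> rat" where "u t \<equiv> (\<Prod>i=1..t. 2 * (3 * of_nat i + 1) - P)"
abbreviation v :: "nat \<Rightarrow> rat" where "v t \<equiv> (\<Prod>i=1..t. 2 * (3 * of_nat i - 1) - P)"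

lemma u_unit:
  assumes "6 * t < 2 * p - 2"
  shows "1 / u t \<in> Z" "u t \<noteq> 0"
  using factor_unit[OF assms] by (auto intro!: inverse_prod_Z)

lemma uv_mem [simp]: "u t \<in> Z" "v t \<in> Z"
  by (intro Z_prod; simp)+

lemma prod_class_2: "(\<Prod>i<t. P - 2 * of_nat (3 * i + 2)) = (- 1) ^ t * v t"
proof -
  have "(\<Prod>i<t. P - 2 * of_nat (3 * i + 2)) = (\<Prod>i<t. - 1 * (2 * (3 * of_nat (Suc i) - 1) - P))"
    by (intro prod.cong) simp_all
  also have "\<dots> = (- 1) ^ t * v t"
    unfolding prod.distrib One_nat_def prod.atLeast1_atMost_eq by simp
  finally show ?thesis .
qed

text \<open>Class 1 starts at \<open>i = 0\<close> and \<open>u t\<close> at \<open>i = 1\<close>: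
  the factor at \<open>t\<close> must be supplied, and the one at 0 is \<open>2 - P\<close>.\<close>

lemma prod_class_1:
  "(\<Prod>i<t. P - 2 * of_nat (3 * i + 1)) * (2 * (3 * of_nat t + 1) - P) = (- 1) ^ t * ((2 - P) * u t)"
proof -
  let ?g = "\<lambda>i. 2 * (3 * of_nat i + 1) - P"
  have "(\<Prod>i<t. P - 2 * of_nat (3 * i + 1)) = (\<Prod>i<t. - 1 * ?g i)"
    by (intro prod.cong) simp_all
  also have "\<dots> = (- 1) ^ t * (\<Prod>i<t. ?g i)"
    unfolding prod.distrib by simp
  finally have "(\<Prod>i<t. P - 2 * of_nat (3 * i + 1)) * ?g t = (- 1) ^ t * prod ?g {..<Suc t}"
    by simp
  also have "prod ?g {..<Suc t} = (2 - P) * u t"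
    unfolding prod.lessThan_Suc_shift One_nat_def prod.atLeast1_atMost_eq by simp
  finally show ?thesis .
qed

lemma S_cg_1_mod_6:
  assumes t: "p = 6 * t + 1"
  shows "cg 2 (S (- 1 / 6) p) ((2 ^ (p - 1) + 2) / (3 * 2 ^ (2 * t)))"
proof -
  let ?W = "2 ^ (p - 1) + 2 :: rat"
  have half: "half = {1..3 * t}" using t by simp
  have P: "P = 6 * of_nat t + 1" using t by simp
  have unit: "1 / u t \<in> Z" "u t \<noteq> 0" using t p_gt_3 by (intro u_unit; simp)+
  have U2: "U 2 = (- 1) ^ t * v t"
    unfolding half using prod_mod_3[where k = 2 and m = t and f = "\<lambda>c. P - 2 * of_nat c"] prod_class_2[of t] by simp
  have "U 1 = (\<Prod>i<t. P - 2 * of_nat (3 * i + 1))"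
    unfolding half by (intro prod_mod_3) simp
  moreover have "2 * (3 * of_nat t + 1) - P = 1" using P by simp
  ultimately have U1: "U 1 = (- 1) ^ t * ((2 - P) * u t)"
    using prod_class_1[of t] by (simp only: mult_1_right)
  have "cg 2 (3 * 2 ^ card {c \<in> half. c mod 3 \<noteq> 2} * U 2) (?W * U 1)"
  proof (rule class_prod_cg)
    show "1 = p mod 3" using t by presburger
    show "(\<Prod>c\<in>{c \<in> half. c mod 3 \<noteq> 2}. (- 1) ^ c) = (1 :: rat)"
      unfolding half by (rule prod_sign_mod_3)
  qed simp
  then have "cg 2 ((- 1) ^ t * (3 * 2 ^ (2 * t) * v t)) ((- 1) ^ t * (?W * (2 - P) * u t))"
    unfolding U1 U2 using card_mod_3(1)[of t] by (simp only: half mult_ac)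
  then have main: "cg 2 (3 * 2 ^ (2 * t) * v t) (?W * (2 - P) * u t)"
    by (rule cg_cancel[rotated 2]) (cases "even t"; simp)+
  \<comment> \<open>Here \<open>3 * (2 * t) + 1 = p\<close>, so \<open>d = 1\<close>.\<close>
  have base: "cg 2 (S (- P / 6) p) ((2 + P) / 4)"
    using S_base[of "2 * t" 1] t p_gt_3 by simp
  have a: "of_nat t - P / 6 = - 1 / 6" unfolding P by (simp add: field_simps)
  have "t < p" using t by simp
  from S_descent[OF this] have desc: "cg 2 (u t * S (- 1 / 6) p) (v t * S (- P / 6) p)"
    unfolding a .
  have "cg 2 (3 * 2 ^ (2 * t) * (u t * S (- 1 / 6) p)) (3 * 2 ^ (2 * t) * (v t * S (- P / 6) p))"
    by (intro cg_cmult desc) simp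
  also have "cg 2 \<dots> (3 * 2 ^ (2 * t) * (v t * ((2 + P) / 4)))"
    by (intro cg_cmult base) simp_all
  also have "\<dots> = (2 + P) / 4 * (3 * 2 ^ (2 * t) * v t)"
    by (simp only: mult_ac)
  also have "cg 2 \<dots> ((2 + P) / 4 * (?W * (2 - P) * u t))"
    by (intro cg_cmult main) simp
  \<comment> \<open>The first-order terms of base value and class quotient cancel:
    \<open>(2 + P) (2 - P) / 4 = 1 - P^2 / 4\<close>.\<close>
  also have "cg 2 \<dots> (?W * u t)"
  proof (rule cgI)
    show "- (?W * u t / 4) \<in> Z" by (intro Z_uminus Z_divide_4 Z_mult) simp_all
    show "(2 + P) / 4 * (?W * (2 - P) * u t) - ?W * u t = P ^ 2 * - (?W * u t / 4)"
      by (simp add: field_simps power2_eq_square)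
  qed
  finally have *: "cg 2 (3 * 2 ^ (2 * t) * u t * S (- 1 / 6) p) (3 * 2 ^ (2 * t) * u t * (?W / (3 * 2 ^ (2 * t))))"
    by (simp add: mult_ac)
  show ?thesis
  proof (rule cg_cancel[OF _ _ *])
    have "1 / 3 * (1 / 2) ^ (2 * t) * (1 / u t) \<in> Z" using unit(1) by (intro Z_mult Z_power) simp_all
    then show "1 / (3 * 2 ^ (2 * t) * u t) \<in> Z" by (simp add: power_divide)
  qed (use unit in simp)
qed

text \<open>The classes exchange roles, so \<open>?W\<close> appears on the side of the sum; it is
  inverted through \<open>?W' * ?W\<close>, which is -9 modulo p^2.\<close>

lemma S_cg_5_mod_6:
  assumes t: "p = 6 * t + 5"
  shows "cg 2 (S (- 1 / 6) p) (2 ^ (2 * t) * (2 ^ (p - 1) - 4))"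
proof -
  let ?W = "2 ^ (p - 1) + 2 :: rat" and ?W' = "2 ^ (p - 1) - 4 :: rat"
  have half: "half = {1..3 * t + 2}" using t by simp
  have P: "P = 6 * of_nat t + 5" using t by simp
  have unit: "1 / u t \<in> Z" "u t \<noteq> 0" using t p_gt_3 by (intro u_unit; simp)+
  \<comment> \<open>Extending the range to a multiple of 3 adds only an element of class 0.\<close>
  have cls: "cls k = {c \<in> {1..3 * Suc t}. c mod 3 = k}" if "k \<noteq> 0" for k
  proof -
    have "c \<in> {1..3 * t + 2} \<longleftrightarrow> c \<in> {1..3 * Suc t}" if "c mod 3 = k" for c
    proof -
      have "c \<noteq> 3 * Suc t" using that \<open>k \<noteq> 0\<close> by auto
      then show ?thesis by auto
    qed
    then show ?thesis unfolding half by auto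
  qed
  have "U 2 = (\<Prod>i<Suc t. P - 2 * of_nat (3 * i + 2))"
    by (subst cls, simp, intro prod_mod_3) simp
  moreover have "P - 2 * of_nat (3 * t + 2) = 1" using P by simp
  ultimately have U2: "U 2 = (- 1) ^ t * v t"
    using prod_class_2[of t] by simp
  have "U 1 = (\<Prod>i<Suc t. P - 2 * of_nat (3 * i + 1))"
    by (subst cls, simp, intro prod_mod_3) simp
  also have "\<dots> = - ((\<Prod>i<t. P - 2 * of_nat (3 * i + 1)) * (2 * (3 * of_nat t + 1) - P))"
    by (simp add: algebra_simps)
  finally have U1: "U 1 = - ((- 1) ^ t * ((2 - P) * u t))"
    unfolding prod_class_1 .
  have "cg 2 (3 * 2 ^ card {c \<in> half. c mod 3 \<noteq> 1} * U 1) (?W * U 2)"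
  proof (rule class_prod_cg)
    show "2 = p mod 3" using t by presburger
    show "(\<Prod>c\<in>{c \<in> half. c mod 3 \<noteq> 1}. (- 1) ^ c) = (1 :: rat)"
      unfolding half by (rule prod_sign_mod_3)
  qed simp
  then have "cg 2 ((- 1) ^ t * - (3 * 2 ^ (2 * t + 1) * (2 - P) * u t)) ((- 1) ^ t * (?W * v t))"
    unfolding U1 U2 using card_mod_3(2)[of t] by (simp only: half mult_ac mult_minus_right)
  then have main: "cg 2 (- (3 * 2 ^ (2 * t + 1) * (2 - P) * u t)) (?W * v t)"
    by (rule cg_cancel[rotated 2]) (cases "even t"; simp)+
  \<comment> \<open>Here \<open>3 * (4 * t + 3) + 1 = 2 * p\<close>, so
    \<open>d = 2\<close>.\<close>
  have base: "cg 2 (S (- P / 6) p) (3 * (2 + P) / 8)"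
    using S_base[of "4 * t + 3" 2] t by simp
  have a: "of_nat t - P / 6 = - 1 - (- 1 / 6)" unfolding P by (simp add: field_simps)
  have S: "S (of_nat t - P / 6) p = S (- 1 / 6) p"
    unfolding a S_def T_symmetric ..
  have "t < p" using t by simp
  from S_descent[OF this] have desc: "cg 2 (u t * S (- 1 / 6) p) (v t * S (- P / 6) p)"
    unfolding S .
  have "cg 2 (?W * (u t * S (- 1 / 6) p)) (?W * (v t * S (- P / 6) p))"
    by (intro cg_cmult desc) simp
  also have "cg 2 \<dots> (?W * (v t * (3 * (2 + P) / 8)))"
  proof (intro cg_cmult base)
  qed simp_all
  also have "\<dots> = 3 * (2 + P) / 8 * (?W * v t)"
    by (simp only: mult_ac)
  also have "cg 2 \<dots> (3 * (2 + P) / 8 * - (3 * 2 ^ (2 * t + 1) * (2 - P) * u t))"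
  proof (intro cg_cmult cg_sym[OF main])
    show "3 * (2 + P) / 8 \<in> Z" using Z_divide_4[of "3 * (2 + P) / 2"] by simp
  qed
  also have "cg 2 \<dots> (- 9 * 2 ^ (2 * t) * u t)"
  proof (rule cgI)
    show "9 * 2 ^ (2 * t) * u t / 4 \<in> Z" by (intro Z_divide_4 Z_mult) simp_all
    show "3 * (2 + P) / 8 * - (3 * 2 ^ (2 * t + 1) * (2 - P) * u t) - (- 9 * 2 ^ (2 * t) * u t)
        = P ^ 2 * (9 * 2 ^ (2 * t) * u t / 4)"
      by (simp add: field_simps power2_eq_square)
  qed
  finally have W: "cg 2 (?W * (u t * S (- 1 / 6) p)) (- 9 * 2 ^ (2 * t) * u t)" .
  \<comment> \<open>Multiplying a congruence by \<open>u t * S (- 1 / 6) p\<close> requires its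
    p-integrality, which is inherited from the base value.\<close>
  have "cg 2 (v t * S (- P / 6) p) (v t * (3 * (2 + P) / 8))"
    by (intro cg_cmult base) simp
  moreover have "3 * (2 + P) / 8 \<in> Z" using Z_divide_4[of "3 * (2 + P) / 2"] by simp
  then have "v t * (3 * (2 + P) / 8) \<in> Z" by (intro Z_mult uv_mem)
  ultimately have mem: "u t * S (- 1 / 6) p \<in> Z"
    using cg_mem[OF desc] cg_mem by blast
  \<comment> \<open>With \<open>2 ^ (p - 1) = 1 + P * c\<close> the product is
    \<open>(P * c - 3) (P * c + 3)\<close>.\<close>
  have "cg 2 (?W' * ?W) (- 9)"
  proof -
    obtain c where c: "c \<in> Z" "2 ^ (p - 1) = 1 + P * c"
    proof -
      from power_2_cg obtain d where "d \<in> Z" "2 ^ (p - 1) - (1 - P * (H half / 2)) = P ^ 2 * d"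
        unfolding cg_def by blast
      then show thesis
        by (intro that[of "P * d - H half / 2"])
          (simp_all add: algebra_simps power2_eq_square)
    qed
    show ?thesis unfolding c(2) using c(1)
      by (intro cgI[of "c ^ 2"]) (simp_all add: algebra_simps power2_eq_square)
  qed
  then have "cg 2 (u t * S (- 1 / 6) p * (?W' * ?W)) (u t * S (- 1 / 6) p * - 9)"
    by (intro cg_cmult mem)
  from cg_sym[OF this]
  have "cg 2 (- 9 * u t * S (- 1 / 6) p) (?W' * (?W * (u t * S (- 1 / 6) p)))"
    by (simp only: mult_ac)
  also have "cg 2 \<dots> (?W' * (- 9 * 2 ^ (2 * t) * u t))"
    by (intro cg_cmult W) simp
  finally have *: "cg 2 (- 9 * u t * S (- 1 / 6) p) (- 9 * u t * (2 ^ (2 * t) * ?W'))"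
    by (simp only: mult_ac)
  show ?thesis
  proof (rule cg_cancel[OF _ _ *])
    have "- (1 / 3 * (1 / 3) * (1 / u t)) \<in> Z" using unit(1) by (intro Z_uminus Z_mult) simp_all
    then show "1 / (- 9 * u t) \<in> Z" by simp
  qed (use unit in simp)
qed

section \<open>Transfer to the stated congruences\<close>

lemma cong_p_integral_if_cg:
  "cg 2 x y \<Longrightarrow> y \<in> Z \<Longrightarrow> cong_p_integral p (of_nat p ^ 2) x y"
  using cg_mem[of 2 x y] unfolding cong_p_integral_def cg_def by blast

lemma sum_eq_S:
  "(\<Sum>k = 0..p - 1. of_nat ((3 * k) choose k) * of_nat ((6 * k) choose (3 * k))
       / (432 ^ k * (3 * of_nat k + 1))) = S (- 1 / 6) p"
proof -
  have "{0..p - 1} = {..<p}" using p_gt_3 by auto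
  then show ?thesis unfolding S_def T_sixth by (intro sum.cong) simp_all
qed

end

theorem theorem2p4:
  fixes p :: nat
  assumes "prime p" and "p > 3"
  shows "([p = 1] (mod 6) \<longrightarrow>
           cong_p_integral p (of_nat p ^ 2)
             (\<Sum>k = 0..p - 1. of_nat ((3 * k) choose k) * of_nat ((6 * k) choose (3 * k))
                              / (432 ^ k * (3 * of_nat k + 1)))
             ((2 ^ (p - 1) + 2) / (3 * 2 ^ ((p - 1) div 3)))) \<and>
         ([p = 5] (mod 6) \<longrightarrow>
           cong_p_integral p (of_nat p ^ 2)
             (\<Sum>k = 0..p - 1. of_nat ((3 * k) choose k) * of_nat ((6 * k) choose (3 * k))
                              / (432 ^ k * (3 * of_nat k + 1)))
             (2 ^ ((p + 1) div 3) * (2 ^ (p - 3) - 1)))"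
proof -
  interpret prime_gt_3 p using assms by unfold_locales
  show ?thesis unfolding sum_eq_S
  proof (intro conjI impI)
    assume "[p = 1] (mod 6)"
    then have "p mod 6 = 1" by (simp add: cong_def)
    then have "p = 6 * (p div 6) + 1" by presburger
    then obtain t where t: "p = 6 * t + 1" by blast
    have "(2 ^ (p - 1) + 2) * (1 / 3 * (1 / 2) ^ (2 * t)) \<in> Z"
      by (intro Z_mult Z_power) simp_all
    then have "(2 ^ (p - 1) + 2) / (3 * 2 ^ (2 * t)) \<in> Z" by (simp add: power_divide)
    moreover have "(p - 1) div 3 = 2 * t" using t by simp
    ultimately show "cong_p_integral p (P ^ 2) (S (- 1 / 6) p) ((2 ^ (p - 1) + 2) / (3 * 2 ^ ((p - 1) div 3)))"
      using S_cg_1_mod_6[OF t] by (simp only: cong_p_integral_if_cg)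
  next
    assume "[p = 5] (mod 6)"
    then have "p mod 6 = 5" by (simp add: cong_def)
    then have "p = 6 * (p div 6) + 5" by presburger
    then obtain t where t: "p = 6 * t + 5" by blast
    have "(p + 1) div 3 = 2 * t + 2" using t by simp
    moreover have "p - 1 = Suc (Suc (p - 3))" using p_gt_3 by simp
    ultimately have "2 ^ (2 * t) * (2 ^ (p - 1) - 4) = (2 ^ ((p + 1) div 3) * (2 ^ (p - 3) - 1) :: rat)"
      by (simp add: power_add algebra_simps)
    with S_cg_5_mod_6[OF t] show "cong_p_integral p (P ^ 2) (S (- 1 / 6) p) (2 ^ ((p + 1) div 3) * (2 ^ (p - 3) - 1))"
      by (intro cong_p_integral_if_cg) simp_all
  qed
qed

end
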